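(* Let $\mathbb{R}=(G,M,I,\prec)$ be a ranked context and let $\mathrel{|\!\sim}_{\mathbb{R}}$ be the consequence relation it induces on the set $\mathcal{L}(M)$ of compound attributes. Then $\mathrel{|\!\sim}_{\mathbb{R}}$ is closed under (RM): for all $\phi,\psi,\gamma\in\mathcal{L}(M)$, if $\phi\mathrel{|\!\sim}_{\mathbb{R}}\psi$ holds and $\phi\mathrel{|\!\sim}_{\mathbb{R}}\neg\gamma$ does not hold, then $\phi\land\gamma\mathrel{|\!\sim}_{\mathbb{R}}\psi$.
   Context: A formal context is a triple $(G,M,I)$ with $G$ a set of objects, $M$ a set of attributes and $I\subseteq G\times M$. The language $\mathcal{L}(M)$ of compound attributes is generated from the attributes $m\in M$ by $\neg,\land,\lor$. Extents $\phi^\downarrow\subseteq G$: $m^\downarrow=\{g\in G\mid (g,m)\in I\}$, $(\neg\phi)^\downarrow=G\setminus\phi^\downarrow$, $(\phi\land\psi)^\downarrow=\phi^\downarrow\cap\psi^\downarrow$, $(\phi\lor\psi)^\downarrow=\phi^\downarrow\cup\psi^\downarrow$. A ranked context is $\mathbb{R}=(G,M,I,\prec)$ where $(G,M,I)$ is a formal context and $\prec$ is a modular strict partial order on $G$; modular means: for all $g_0,g_1,g_2\in G$, if $g_0\not\prec g_1$, $g_1\not\prec g_0$ and $g_2\prec g_0$, then $g_2\prec g_1$. For $B\subseteq G$ let $\underline{B}=\{g\in B\mid \nexists h\in B,\ h\prec g\}$. The induced relation is: $\phi\mathrel{|\!\sim}_{\mathbb{R}}\psi$ iff $\underline{\phi^\downarrow}\subseteq\psi^\downarrow$.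 *)

theory Defs
  imports Main
begin

locale formal_context =
  fixes G :: "'g set" and M :: "'m set" and I :: "('g \<times> 'm) set"
  assumes incidence: "I \<subseteq> G \<times> M"

datatype 'm compound =
    Attr 'm
  | Neg "'m compound"                 (\<open>\<^bold>\<not> _\<close> [40] 40)
  | Conj "'m compound" "'m compound"  (infixr \<open>\<^bold>\<and>\<close> 35)
  | Disj "'m compound" "'m compound"  (infixr \<open>\<^bold>\<or>\<close> 30)

inductive_set language :: "'m set \<Rightarrow> 'm compound set" for M :: "'m set" where
  attr: "m \<in> M \<Longrightarrow> Attr m \<in> language M"
| neg: "\<phi> \<in> language M \<Longrightarrow> (\<^bold>\<not> \<phi>) \<in> language M"
| conj: "\<phi> \<in> language M \<Longrightarrow> \<psi> \<in> language M \<Longrightarrow> (\<phi> \<^bold>\<and> \<psi>) \<in> language M"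
| disj: "\<phi> \<in> language M \<Longrightarrow> \<psi> \<in> language M \<Longrightarrow> (\<phi> \<^bold>\<or> \<psi>) \<in> language M"

primrec extent :: "'g set \<Rightarrow> ('g \<times> 'm) set \<Rightarrow> 'm compound \<Rightarrow> 'g set" where
  "extent G I (Attr m) = {g \<in> G. (g, m) \<in> I}"
| "extent G I (\<^bold>\<not> \<phi>) = G - extent G I \<phi>"
| "extent G I (\<phi> \<^bold>\<and> \<psi>) = extent G I \<phi> \<inter> extent G I \<psi>"
| "extent G I (\<phi> \<^bold>\<or> \<psi>) = extent G I \<phi> \<union> extent G I \<psi>"

text \<open>A pair \<open>(h, g) \<in> prec\<close> stands for \<open>h \<prec> g\<close>.\<close>

definition modular_on :: "'g set \<Rightarrow> ('g \<times> 'g) set \<Rightarrow> bool" where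
  "modular_on G prec \<longleftrightarrow>
    (\<forall>g\<^sub>0\<in>G. \<forall>g\<^sub>1\<in>G. \<forall>g\<^sub>2\<in>G.
      (g\<^sub>0, g\<^sub>1) \<notin> prec \<and> (g\<^sub>1, g\<^sub>0) \<notin> prec \<and> (g\<^sub>2, g\<^sub>0) \<in> prec \<longrightarrow> (g\<^sub>2, g\<^sub>1) \<in> prec)"

locale ranked_context = formal_context G M I
  for G :: "'g set" and M :: "'m set" and I :: "('g \<times> 'm) set" +
  fixes prec :: "('g \<times> 'g) set"
  assumes prec_on: "prec \<subseteq> G \<times> G"
    and prec_irrefl: "irrefl_on G prec"
    and prec_trans: "trans_on G prec"
    and prec_modular: "modular_on G prec"

definition minimal :: "('g \<times> 'g) set \<Rightarrow> 'g set \<Rightarrow> 'g set" where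
  "minimal prec B = {g \<in> B. \<not> (\<exists>h\<in>B. (h, g) \<in> prec)}"

definition ranked_entails ::
  "'g set \<Rightarrow> ('g \<times> 'm) set \<Rightarrow> ('g \<times> 'g) set \<Rightarrow> 'm compound \<Rightarrow> 'm compound \<Rightarrow> bool" where
  "ranked_entails G I prec \<phi> \<psi> \<longleftrightarrow> minimal prec (extent G I \<phi>) \<subseteq> extent G I \<psi>"

end

theory Submission
  imports Defs
begin

lemma extent_subset: "extent G I \<phi> \<subseteq> G"
  by (induction \<phi>) auto

text \<open>If \<open>C\<close> contains a minimal element \<open>g\<^sub>0\<close> of \<open>B\<close>, then every minimal element of \<open>B \<inter> C\<close> is
  incomparable to \<open>g\<^sub>0\<close>, and by modularity anything below it would be below \<open>g\<^sub>0\<close>.\<close>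

lemma minimal_Int_subset:
  assumes "modular_on G prec" and "B \<subseteq> G" and "minimal prec B \<inter> C \<noteq> {}"
  shows "minimal prec (B \<inter> C) \<subseteq> minimal prec B"
proof
  fix g assume g: "g \<in> minimal prec (B \<inter> C)"
  obtain g\<^sub>0 where g\<^sub>0: "g\<^sub>0 \<in> minimal prec B" "g\<^sub>0 \<in> C"
    using assms(3) by blast
  \<comment> \<open>\<open>g\<^sub>0\<close> lies in \<open>B \<inter> C\<close>, where
    \<open>g\<close> is minimal, and \<open>g\<close> lies in \<open>B\<close>, where
    \<open>g\<^sub>0\<close> is minimal.\<close>
  have "(g\<^sub>0, g) \<notin> prec" "(g, g\<^sub>0) \<notin> prec"
    using g g\<^sub>0 by (auto simp: minimal_def)
  moreover have "g \<in> G" "g\<^sub>0 \<in> G"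
    using g g\<^sub>0 assms(2) by (auto simp: minimal_def)
  \<comment> \<open>In \<open>modular_on\<close>, \<open>g\<close> and the present
    \<open>g\<^sub>0\<close> take the places of \<open>g\<^sub>0\<close> and
    \<open>g\<^sub>1\<close>.\<close>
  ultimately have "(h, g\<^sub>0) \<in> prec" if "h \<in> B" "(h, g) \<in> prec" for h
    using that assms(1,2) unfolding modular_on_def by blast
  then show "g \<in> minimal prec B"
    using g g\<^sub>0(1) by (auto simp: minimal_def)
qed

theorem theorem5:
  fixes G :: "'g set" and M :: "'m set" and I :: "('g \<times> 'm) set" and prec :: "('g \<times> 'g) set"
    and \<phi> \<psi> \<gamma> :: "'m compound"
  assumes "ranked_context G M I prec"
    and "\<phi> \<in> language M" and "\<psi> \<in> language M" and "\<gamma> \<in> language M"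
    and "ranked_entails G I prec \<phi> \<psi>"
    and "\<not> ranked_entails G I prec \<phi> (\<^bold>\<not> \<gamma>)"
  shows "ranked_entails G I prec (\<phi> \<^bold>\<and> \<gamma>) \<psi>"
proof -
  \<comment> \<open>Negation is complement relative to \<open>G\<close>: a minimal object outside
    \<open>G - extent G I \<gamma>\<close> has \<gamma> because it lies in \<open>G\<close>.\<close>
  have "minimal prec (extent G I \<phi>) \<subseteq> G"
    using extent_subset[of G I \<phi>] by (auto simp: minimal_def)
  then have "minimal prec (extent G I \<phi>) \<inter> extent G I \<gamma> \<noteq> {}"
    using assms(6) by (auto simp: ranked_entails_def)
  then have "minimal prec (extent G I \<phi> \<inter> extent G I \<gamma>) \<subseteq> minimal prec (extent G I \<phi>)"
    using minimal_Int_subset[OF ranked_context.prec_modular[OF assms(1)] extent_subset] by blast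
  then show ?thesis
    using assms(5) by (auto simp: ranked_entails_def)
qed

end
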